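(* Let $a>b>0$, let $\mathcal{E}$ be the ellipse $(x/a)^2+(y/b)^2=1$, and let $k_7=\sqrt{4a^4-5a^2b^2+b^4}$. The circle with center $C_7=\left[\frac{k_7}{2a},0\right]$ and radius $r_7=\frac{b^2}{2a}$ is a caustic admitting a Poncelet family of triangles inscribed in $\mathcal{E}$, and over this family the Gergonne point is stationary at $$X_7=\left[\frac{2a\,k_7}{4a^2-b^2},0\right].$$
   Context: Points of the plane are written $[x,y]$. A circle is a caustic admitting a Poncelet family of triangles inscribed in $\mathcal{E}$ if every point of $\mathcal{E}$ is a vertex of a triangle whose three vertices lie on $\mathcal{E}$ and whose three sidelines are tangent to the circle (here, the circle is the fixed incircle of the triangles); the family is the set of all such triangles. The Gergonne point $X_7$ of a triangle is the point of concurrence of the lines joining each vertex to the point where the incircle touches the opposite side. A point is stationary over a family if it is the same for all triangles in the family. *)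

theory Defs
  imports "HOL-Analysis.Analysis"
begin

text \<open>Points are pairs of reals; the product metric on \<^typ>\<open>real \<times> real\<close> is the Euclidean one.\<close>

definition ellipse :: "real \<Rightarrow> real \<Rightarrow> (real \<times> real) set" where
  "ellipse a b = {(x, y). (x / a)\<^sup>2 + (y / b)\<^sup>2 = 1}"

text \<open>For a circle of positive radius, a line is tangent iff it meets the circle in exactly one
  point; naming that point gives the point of contact.\<close>

definition line_touches_circle_at ::
  "real \<times> real \<Rightarrow> real \<times> real \<Rightarrow> real \<times> real \<Rightarrow> real \<Rightarrow> real \<times> real \<Rightarrow> bool" where
  "line_touches_circle_at A B P r T \<longleftrightarrow> affine hull {A, B} \<inter> sphere P r = {T}"

definition sideline_tangent ::
  "real \<times> real \<Rightarrow> real \<times> real \<Rightarrow> real \<times> real \<Rightarrow> real \<Rightarrow> bool" where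
  "sideline_tangent A B P r \<longleftrightarrow> (\<exists>T. line_touches_circle_at A B P r T)"

definition poncelet_family ::
  "(real \<times> real) set \<Rightarrow> real \<times> real \<Rightarrow> real \<Rightarrow> ((real \<times> real) \<times> (real \<times> real) \<times> (real \<times> real)) set" where
  "poncelet_family \<E> P r = {(A, B, C). A \<in> \<E> \<and> B \<in> \<E> \<and> C \<in> \<E> \<and> \<not> collinear {A, B, C} \<and>
     sideline_tangent B C P r \<and> sideline_tangent C A P r \<and> sideline_tangent A B P r}"

definition poncelet_triangle_caustic ::
  "(real \<times> real) set \<Rightarrow> real \<times> real \<Rightarrow> real \<Rightarrow> bool" where
  "poncelet_triangle_caustic \<E> P r \<longleftrightarrow>
     r > 0 \<and> (\<forall>A\<in>\<E>. \<exists>B C. (A, B, C) \<in> poncelet_family \<E> P r)"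

text \<open>Containment in the triangle is what separates the incircle from the three excircles, which
  are tangent to the same sidelines.\<close>

definition is_incircle ::
  "real \<times> real \<Rightarrow> real \<times> real \<Rightarrow> real \<times> real \<Rightarrow> real \<times> real \<Rightarrow> real \<Rightarrow> bool" where
  "is_incircle A B C P r \<longleftrightarrow> \<not> collinear {A, B, C} \<and> r > 0 \<and>
     sphere P r \<subseteq> convex hull {A, B, C} \<and>
     sideline_tangent B C P r \<and> sideline_tangent C A P r \<and> sideline_tangent A B P r"

definition is_gergonne_point ::
  "real \<times> real \<Rightarrow> real \<times> real \<Rightarrow> real \<times> real \<Rightarrow> real \<times> real \<Rightarrow> bool" where
  "is_gergonne_point A B C X \<longleftrightarrow>
     (\<exists>P r D E F. is_incircle A B C P r \<and>
        line_touches_circle_at B C P r D \<and>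
        line_touches_circle_at C A P r E \<and>
        line_touches_circle_at A B P r F \<and>
        affine hull {A, D} \<inter> affine hull {B, E} \<inter> affine hull {C, F} = {X})"

end

theory Submission
  imports Defs
begin

text \<open>
  The configuration is a projective image of the most symmetric one: the unit circle, the
  concentric circle of radius 2, and the equilateral triangles inscribed in the latter. Every
  chord of the large circle that touches the small one subtends a third of the circle and touches
  at its midpoint, so these triangles circumscribe the unit circle, one through each point of the
  large circle, and their cevians to the points of contact all pass through the common centre.

  A projective map keeps lines, tangency to a conic, points of contact and concurrence. It keeps
  convex hulls too, as long as the line that it sends to infinity stays away from them. Hence the
  theorem follows from one projective map that takes the unit circle to the circle with centre
  \<open>C7\<close> and radius \<open>r7\<close>, the circle of radius 2 to the ellipse, and the common centre to \<open>X7\<close>.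

  Such a map is found among those that keep the unit circle, followed by the homothety onto the
  incircle. The projective maps of the plane that keep the unit disk are the isometries of the
  hyperbolic plane in the Klein model; the symmetry about the major axis singles out the
  translations \<open>disk_shift s\<close>, which move the centre to \<open>(s, 0)\<close>. The requirement that the centre
  go to \<open>X7\<close> forces \<open>s = k7 / (4 * a\<^sup>2 - b\<^sup>2)\<close>, and then \<open>shifted_circle_in_ellipse_iff\<close> says that
  the circle of radius 2 goes to the ellipse. Since \<open>s < 1 / 2\<close>, the line sent to infinity misses
  the disk of radius 2.

  The locale \<open>projective_picture\<close> isolates the transport along such a map. Its inverse is needed
  as well: a triangle of the family is pulled back to points of the circle of radius 2 whose
  joining chords touch the unit circle, which makes it equilateral, and so every member of the
  family is covered and not only those that were constructed.
\<close>

section \<open>Projective maps as quotients of affine maps\<close>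

text \<open>A projective map in an affine chart: the quotient of an affine map \<open>w *\<^sub>R f\<close> by the affine
  function \<open>w\<close>, which vanishes on the line sent to infinity. Only points where \<open>w\<close> is positive are
  constrained, since division by zero would make \<open>w *\<^sub>R f\<close> vanish on that line, which the affine
  numerator need not do.\<close>

definition fractional_affine :: "('a::real_vector \<Rightarrow> real) \<Rightarrow> ('a \<Rightarrow> 'b::real_vector) \<Rightarrow> bool" where
  "fractional_affine w f \<longleftrightarrow> (\<forall>x y s t. s + t = 1 \<longrightarrow>
     w (s *\<^sub>R x + t *\<^sub>R y) = s * w x + t * w y \<and>
     (w x > 0 \<longrightarrow> w y > 0 \<longrightarrow> w (s *\<^sub>R x + t *\<^sub>R y) > 0 \<longrightarrow>
       w (s *\<^sub>R x + t *\<^sub>R y) *\<^sub>R f (s *\<^sub>R x + t *\<^sub>R y) = (s * w x) *\<^sub>R f x + (t * w y) *\<^sub>R f y))"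

text \<open>Projective maps send barycentric coordinates to barycentric coordinates with the weights
  multiplied by \<open>w\<close>. The sign of a coordinate is kept where \<open>w\<close> is positive, which is why convex
  hulls survive as well as lines.\<close>

lemma fractional_affine_combination:
  assumes "fractional_affine w f" "s + t = 1" "w x > 0" "w y > 0" "w (s *\<^sub>R x + t *\<^sub>R y) > 0"
  defines "z \<equiv> s *\<^sub>R x + t *\<^sub>R y"
  shows "f z = (s * w x / w z) *\<^sub>R f x + (t * w y / w z) *\<^sub>R f y"
    and "s * w x / w z + t * w y / w z = 1"
proof -
  have w: "w z = s * w x + t * w y" and wf: "w z *\<^sub>R f z = (s * w x) *\<^sub>R f x + (t * w y) *\<^sub>R f y"
    using assms unfolding fractional_affine_def by blast+
  have nz: "w z \<noteq> 0" using assms by simp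
  have "f z = (1 / w z) *\<^sub>R (w z *\<^sub>R f z)" using nz by simp
  also have "\<dots> = (s * w x / w z) *\<^sub>R f x + (t * w y / w z) *\<^sub>R f y"
    by (simp only: wf) (simp add: scaleR_add_right)
  finally show "f z = (s * w x / w z) *\<^sub>R f x + (t * w y / w z) *\<^sub>R f y" .
  show "s * w x / w z + t * w y / w z = 1"
    using nz w by (simp add: add_divide_distrib[symmetric])
qed

lemma fractional_affine_line:
  assumes "fractional_affine w f" "w p > 0" "w q > 0" "w x > 0" "x \<in> affine hull {p, q}"
  shows "f x \<in> affine hull {f p, f q}"
proof -
  obtain s t where st: "s + t = 1" and x: "x = s *\<^sub>R p + t *\<^sub>R q"
    using assms(5) by (auto simp: affine_hull_2)
  show ?thesis
    using fractional_affine_combination[OF assms(1) st assms(2,3)] assms(4)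
    unfolding x affine_hull_2 by blast
qed

lemma fractional_affine_convex_hull:
  assumes f: "fractional_affine w f" and S: "\<And>x. x \<in> S \<Longrightarrow> w x > 0" and x: "x \<in> convex hull S"
  shows "f x \<in> convex hull (f ` S)"
proof -
  \<comment> \<open>Positivity of \<open>w\<close> is carried along because the next point of a segment can only be
      controlled when both endpoints lie on the positive side.\<close>
  let ?T = "{x. w x > 0 \<and> f x \<in> convex hull (f ` S)}"
  have "convex ?T"
  proof (rule convexI)
    fix x y and s t :: real
    assume x: "x \<in> ?T" and y: "y \<in> ?T" and st: "0 \<le> s" "0 \<le> t" "s + t = 1"
    let ?z = "s *\<^sub>R x + t *\<^sub>R y"
    have "w ?z = s * w x + t * w y"
      using f st unfolding fractional_affine_def by blast
    also have "\<dots> > 0"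
      using x y st by (cases "s = 0") (auto intro!: add_pos_nonneg)
    finally have z: "w ?z > 0" .
    have "f ?z \<in> convex hull (f ` S)"
      using fractional_affine_combination[OF f st(3) _ _ z] x y z st
        convexD[OF convex_convex_hull, of "f x" "f ` S" "f y" "s * w x / w ?z" "t * w y / w ?z"]
      by simp
    with z show "?z \<in> ?T" by simp
  qed
  then have "convex hull S \<subseteq> ?T"
    by (intro hull_minimal) (auto intro: S hull_inc)
  with x show ?thesis by blast
qed

section \<open>Equilateral triangles between concentric circles\<close>

text \<open>For \<open>P \<bullet> Q = -2\<close> the squared norm along the line is \<open>1 + 3 * (2 * s - 1)\<^sup>2\<close>, which attains 1
  only at the midpoint.\<close>

lemma chord_touches_half_circle:
  fixes P Q :: "'a::real_inner"
  assumes "norm P = 2" "norm Q = 2" and "P \<bullet> Q = -2"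
  shows "affine hull {P, Q} \<inter> sphere 0 1 = {(1/2) *\<^sub>R (P + Q)}"
proof -
  have PP: "P \<bullet> P = 4" "Q \<bullet> Q = 4" using assms by (simp_all add: dot_square_norm)
  have nrm: "norm (s *\<^sub>R P + t *\<^sub>R Q) = 1 \<longleftrightarrow> s = 1/2 \<and> t = 1/2" if "s + t = 1" for s t
  proof -
    have t: "t = 1 - s" using that by simp
    have "(s *\<^sub>R P + t *\<^sub>R Q) \<bullet> (s *\<^sub>R P + t *\<^sub>R Q) = 1 + 3 * (2 * s - 1)\<^sup>2"
      using PP assms(3)
      by (simp add: t inner_add_left inner_add_right inner_commute[of Q P])
        (simp add: algebra_simps power2_eq_square)
    then have "norm (s *\<^sub>R P + t *\<^sub>R Q) = 1 \<longleftrightarrow> 3 * (2 * s - 1)\<^sup>2 = 0"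
      unfolding norm_eq_1 by simp
    then show ?thesis using t by auto
  qed
  have mid: "(1/2) *\<^sub>R (P + Q) = (1/2) *\<^sub>R P + (1/2) *\<^sub>R Q" by (rule scaleR_add_right)
  show ?thesis
  proof (intro equalityI subsetI)
    fix x assume "x \<in> affine hull {P, Q} \<inter> sphere 0 1"
    then obtain s t where "s + t = 1" "x = s *\<^sub>R P + t *\<^sub>R Q" "norm x = 1"
      unfolding affine_hull_2 by auto
    then show "x \<in> {(1/2) *\<^sub>R (P + Q)}" using nrm[of s t] unfolding mid by fastforce
  next
    fix x assume "x \<in> {(1/2) *\<^sub>R (P + Q)}"
    then have x: "x = (1/2) *\<^sub>R P + (1/2) *\<^sub>R Q" by (simp only: mid singleton_iff)
    then have "x \<in> affine hull {P, Q}"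
      unfolding affine_hull_2 mem_Collect_eq by (intro exI[of _ "1/2"]) simp
    moreover have "norm x = 1" unfolding x by (subst nrm) simp_all
    ultimately show "x \<in> affine hull {P, Q} \<inter> sphere 0 1" by simp
  qed
qed

text \<open>Exchanging the two endpoints preserves both the line and the circle, so a unique common
  point is the midpoint; its norm then determines the inner product.\<close>

lemma tangent_chord_inner:
  fixes P Q :: "'a::real_inner"
  assumes "norm P = 2" "norm Q = 2" "P \<noteq> Q" and T: "affine hull {P, Q} \<inter> sphere 0 1 = {T}"
  shows "P \<bullet> Q = -2"
proof -
  have PP: "P \<bullet> P = 4" "Q \<bullet> Q = 4" using assms by (simp_all add: dot_square_norm)
  obtain s t where st: "s + t = 1" and Teq: "T = s *\<^sub>R P + t *\<^sub>R Q" and n: "norm T = 1"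
    using T unfolding affine_hull_2 by fastforce
  let ?T' = "t *\<^sub>R P + s *\<^sub>R Q"
  have "?T' \<bullet> ?T' = T \<bullet> T"
    by (simp add: Teq PP inner_add_left inner_add_right inner_commute[of Q P] algebra_simps)
  then have "?T' \<in> sphere 0 1" using n by (simp add: norm_eq_sqrt_inner)
  moreover have "?T' \<in> affine hull {P, Q}"
    unfolding affine_hull_2 mem_Collect_eq using st
    by (intro exI[of _ t] exI[of _ s]) (simp add: add.commute)
  ultimately have "?T' = T" using T by blast
  then have "(s - t) *\<^sub>R (P - Q) = 0" by (simp add: Teq algebra_simps)
  then have "s = 1/2" "t = 1/2" using assms(3) st by auto
  with n Teq have "(1/2) *\<^sub>R P + (1/2) *\<^sub>R Q \<in> {x. x \<bullet> x = 1}" by (simp add: norm_eq_1)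
  then show ?thesis
    using PP by (simp add: inner_add_left inner_add_right inner_commute[of Q P] field_simps)
qed

text \<open>The squared norm of the sum is \<open>3 * 4 + 6 * (-2) = 0\<close>.\<close>

lemma sum_eq_0_of_equilateral:
  fixes P Q R :: "'a::real_inner"
  assumes "norm P = 2" "norm Q = 2" "norm R = 2" "P \<bullet> Q = -2" "Q \<bullet> R = -2" "R \<bullet> P = -2"
  shows "P + Q + R = 0"
proof -
  have "P \<bullet> P = 4" "Q \<bullet> Q = 4" "R \<bullet> R = 4" using assms by (simp_all add: dot_square_norm)
  then have "(P + Q + R) \<bullet> (P + Q + R) = 0"
    using assms(4-6)
    by (simp add: inner_add_left inner_add_right inner_commute[of Q P] inner_commute[of R Q]
        inner_commute[of P R])
  then show ?thesis by simp
qed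

text \<open>A point \<open>X\<close> has the barycentric coordinates \<open>1/3 + (X \<bullet> V) / 6\<close> at the three vertices \<open>V\<close>,
  because the vertices sum to zero and form a tight frame of the plane. For \<open>X\<close> of norm 1 the
  Cauchy-Schwarz inequality bounds \<open>X \<bullet> V\<close> by 2, so the coordinates are nonnegative.\<close>

lemma equilateral_contains_incircle:
  fixes P Q R :: "real \<times> real"
  assumes "norm P = 2" "norm Q = 2" "norm R = 2" "P \<bullet> Q = -2" "Q \<bullet> R = -2" "R \<bullet> P = -2"
  shows "sphere 0 1 \<subseteq> convex hull {P, Q, R}"
proof
  fix X :: "real \<times> real" assume "X \<in> sphere 0 1"
  then have X: "norm X = 1" by simp
  have sq: "P \<bullet> P = 4" "Q \<bullet> Q = 4" "R \<bullet> R = 4" using assms by (simp_all add: dot_square_norm)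
  have sum: "P + Q + R = 0" by (rule sum_eq_0_of_equilateral) fact+
  then have R: "R = - P - Q" by (simp add: algebra_simps add_eq_0_iff)
  let ?c = "\<lambda>P. 1/3 + (X \<bullet> P) / 6"
  have nonneg: "?c V \<ge> 0" if "norm V = 2" for V
    using Cauchy_Schwarz_ineq2[of X V] X that by simp
  have sum1: "?c P + ?c Q + ?c R = 1" by (simp add: R inner_diff_right add_divide_distrib diff_divide_distrib)
  \<comment> \<open>The frame identity holds since the error is orthogonal to two independent vectors.\<close>
  define Y where "Y = X - (?c P *\<^sub>R P + ?c Q *\<^sub>R Q + ?c R *\<^sub>R R)"
  have "Y \<bullet> P = 0" "Y \<bullet> Q = 0"
    using sq assms(4)
    by (simp_all add: Y_def R inner_diff_left inner_add_left inner_diff_right inner_commute[of Q P])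
       (simp_all add: field_simps)
  then have YP: "fst Y * fst P + snd Y * snd P = 0" and YQ: "fst Y * fst Q + snd Y * snd Q = 0"
    by (simp_all add: inner_prod_def)
  let ?d = "fst P * snd Q - snd P * fst Q"
  have "?d\<^sup>2 = (P \<bullet> P) * (Q \<bullet> Q) - (P \<bullet> Q)\<^sup>2"
    by (simp add: inner_prod_def power2_eq_square algebra_simps)
  then have d: "?d \<noteq> 0" using sq assms(4) by auto
  have "fst Y * ?d = 0" "snd Y * ?d = 0" using YP YQ by algebra+
  then have "Y = 0" using d by (simp add: prod_eq_iff)
  then have "X = ?c P *\<^sub>R P + ?c Q *\<^sub>R Q + ?c R *\<^sub>R R" by (simp add: Y_def)
  then show "X \<in> convex hull {P, Q, R}"
    unfolding convex_hull_3 using nonneg[OF assms(1)] nonneg[OF assms(2)] nonneg[OF assms(3)] sum1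
    by blast
qed

lemma equilateral_exists:
  fixes P :: "real \<times> real"
  assumes "norm P = 2"
  obtains Q R where "norm Q = 2" "norm R = 2" "P \<bullet> Q = -2" "Q \<bullet> R = -2" "R \<bullet> P = -2"
proof -
  obtain x y where P: "P = (x, y)" by (cases P)
  have "P \<bullet> P = 4" using assms by (simp add: dot_square_norm)
  then have xy: "x * x + y * y = 4" by (simp add: P inner_prod_def)
  \<comment> \<open>The other two vertices are the rotations by a third of a turn; \<open>h\<close> is its sine.\<close>
  define h :: real where "h = sqrt 3 / 2"
  have h: "h * h = 3 / 4" by (simp add: h_def)
  define Q R where "Q = (- x / 2 - h * y, h * x - y / 2)" and "R = (- x / 2 + h * y, - h * x - y / 2)"
  have "Q \<bullet> Q = (1/4 + h * h) * (x * x + y * y)" "R \<bullet> R = (1/4 + h * h) * (x * x + y * y)"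
    "P \<bullet> Q = - (1/2) * (x * x + y * y)" "Q \<bullet> R = (1/4 - h * h) * (x * x + y * y)"
    "R \<bullet> P = - (1/2) * (x * x + y * y)"
    by (simp_all add: P Q_def R_def inner_prod_def algebra_simps)
  then have "Q \<bullet> Q = 4" "R \<bullet> R = 4" "P \<bullet> Q = -2" "Q \<bullet> R = -2" "R \<bullet> P = -2"
    unfolding xy h by simp_all
  moreover from this have "norm Q = 2" "norm R = 2" by (simp_all add: norm_eq_sqrt_inner)
  ultimately show thesis using that by blast
qed

lemma not_collinear_0_of_equilateral:
  fixes P Q :: "real \<times> real"
  assumes "norm P = 2" "norm Q = 2" "P \<bullet> Q = -2"
  shows "\<not> collinear {0, P, Q}"
proof
  assume "collinear {0, P, Q}"
  then have "\<bar>P \<bullet> Q\<bar> = norm P * norm Q" by (simp add: norm_cauchy_schwarz_equal)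
  then show False using assms by simp
qed

lemma not_collinear_equilateral:
  fixes P Q R :: "real \<times> real"
  assumes "norm P = 2" "norm Q = 2" "P \<bullet> Q = -2" "P + Q + R = 0"
  shows "\<not> collinear {P, Q, R}"
proof
  assume c: "collinear {P, Q, R}"
  have "P \<noteq> Q" using assms by (auto simp: dot_square_norm)
  then obtain s t where st: "s + t = 1" and R: "R = s *\<^sub>R P + t *\<^sub>R Q"
    using c by (auto simp: collinear_3_affine_hull affine_hull_2)
  then have 0: "(1 + s) *\<^sub>R P + (1 + t) *\<^sub>R Q = 0"
    using assms(4) by (simp add: algebra_simps)
  \<comment> \<open>Pairing with \<open>P + Q\<close> gives \<open>2 * 3\<close>, as \<open>s + t = 1\<close>.\<close>
  have "((1 + s) *\<^sub>R P + (1 + t) *\<^sub>R Q) \<bullet> (P + Q) = 2 * (2 + s + t)"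
    using assms
    by (simp add: inner_add_left inner_add_right inner_commute[of Q P] dot_square_norm)
  then show False using st unfolding 0 by simp
qed

section \<open>Transport along a projective map\<close>

text \<open>The map \<open>f\<close> with denominator \<open>w\<close> and its inverse \<open>g\<close> with denominator \<open>v\<close> identify the half
  planes \<open>w > 0\<close> and \<open>v > 0\<close>. These contain the disk of radius 2 and the two curves \<open>E\<close> and
  \<open>sphere C r\<close>, the images of the circles of radius 2 and 1.\<close>

locale projective_picture =
  fixes f g :: "real \<times> real \<Rightarrow> real \<times> real" and w v :: "real \<times> real \<Rightarrow> real"
    and E :: "(real \<times> real) set" and C :: "real \<times> real" and r :: real
  assumes f: "fractional_affine w f" and g: "fractional_affine v g"
    and gf: "w x > 0 \<Longrightarrow> g (f x) = x" and fg: "v y > 0 \<Longrightarrow> f (g y) = y"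
    and v_f: "w x > 0 \<Longrightarrow> v (f x) > 0"
    and r: "r > 0"
    and w_pos: "norm x \<le> 2 \<Longrightarrow> w x > 0"
    and f_unit: "norm x = 1 \<Longrightarrow> f x \<in> sphere C r"
    and g_sphere: "y \<in> sphere C r \<Longrightarrow> v y > 0 \<and> norm (g y) = 1"
    and f_double: "norm x = 2 \<Longrightarrow> f x \<in> E"
    and g_E: "y \<in> E \<Longrightarrow> v y > 0 \<and> norm (g y) = 2"
begin

lemma line_iff:
  assumes "w p > 0" "w q > 0" "w x > 0"
  shows "f x \<in> affine hull {f p, f q} \<longleftrightarrow> x \<in> affine hull {p, q}"
proof
  assume "f x \<in> affine hull {f p, f q}"
  then have "g (f x) \<in> affine hull {g (f p), g (f q)}"
    by (intro fractional_affine_line[OF g] v_f assms)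
  then show "x \<in> affine hull {p, q}" by (simp add: gf assms)
next
  assume "x \<in> affine hull {p, q}"
  then show "f x \<in> affine hull {f p, f q}" by (intro fractional_affine_line[OF f] assms)
qed

lemma line_inter_sphere:
  assumes "w p > 0" "w q > 0"
  shows "affine hull {f p, f q} \<inter> sphere C r = f ` (affine hull {p, q} \<inter> sphere 0 1)"
proof (intro equalityI subsetI)
  fix y assume y: "y \<in> affine hull {f p, f q} \<inter> sphere C r"
  then have "v y > 0" "norm (g y) = 1" using g_sphere by auto
  moreover from this have "f (g y) = y" "w (g y) > 0" using fg w_pos by auto
  ultimately show "y \<in> f ` (affine hull {p, q} \<inter> sphere 0 1)"
    using y line_iff[OF assms, of "g y"] by (intro image_eqI[of _ _ "g y"]) auto
next
  fix y assume "y \<in> f ` (affine hull {p, q} \<inter> sphere 0 1)"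
  then show "y \<in> affine hull {f p, f q} \<inter> sphere C r"
    using line_iff[OF assms] f_unit w_pos by auto
qed

lemma touches_at_midpoint:
  assumes "norm P = 2" "norm Q = 2" "P \<bullet> Q = -2"
  shows "line_touches_circle_at (f P) (f Q) C r (f ((1/2) *\<^sub>R (P + Q)))"
  using line_inter_sphere[of P Q] w_pos assms(1,2)
  unfolding line_touches_circle_at_def chord_touches_half_circle[OF assms] by simp

lemma sideline_tangent_iff:
  assumes "norm P = 2" "norm Q = 2" "P \<noteq> Q"
  shows "sideline_tangent (f P) (f Q) C r \<longleftrightarrow> P \<bullet> Q = -2"
proof
  assume "sideline_tangent (f P) (f Q) C r"
  then obtain T where T: "f ` (affine hull {P, Q} \<inter> sphere 0 1) = {T}"
    using line_inter_sphere w_pos assms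
    by (auto simp: sideline_tangent_def line_touches_circle_at_def)
  let ?L = "affine hull {P, Q} \<inter> sphere 0 1"
  have "g ` f ` ?L = ?L"
    unfolding image_image by (rule image_cong[OF refl, of _ _ id, simplified]) (simp add: gf w_pos)
  then have "?L = {g T}" using T by simp
  then show "P \<bullet> Q = -2" using tangent_chord_inner assms by blast
next
  assume "P \<bullet> Q = -2"
  then show "sideline_tangent (f P) (f Q) C r"
    unfolding sideline_tangent_def using touches_at_midpoint assms(1,2) by blast
qed

text \<open>In a triangle centred at 0, the midpoint of a side is minus half the opposite vertex.\<close>

lemma touches_at:
  assumes "norm P = 2" "norm Q = 2" "P \<bullet> Q = -2" "P + Q + R = 0"
  shows "line_touches_circle_at (f P) (f Q) C r (f (- (1/2) *\<^sub>R R))"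
proof -
  have "P + Q = - R" using assms(4) by (simp add: add_eq_0_iff2)
  then have "(1/2) *\<^sub>R (P + Q) = - (1/2) *\<^sub>R R" by simp
  then show ?thesis using touches_at_midpoint[OF assms(1-3)] by metis
qed

lemma not_collinear_image:
  assumes "w x > 0" "w y > 0" "w z > 0" "\<not> collinear {x, y, z}"
  shows "\<not> collinear {f x, f y, f z}"
proof
  assume c: "collinear {f x, f y, f z}"
  have "x \<noteq> y" using assms(4) by auto
  then have "f x \<noteq> f y" using gf assms(1,2) by metis
  with c have "f z \<in> affine hull {f x, f y}" by (simp add: collinear_3_affine_hull)
  then have "z \<in> affine hull {x, y}" using line_iff assms by blast
  then show False using assms(4) \<open>x \<noteq> y\<close> by (simp add: collinear_3_affine_hull)
qed

lemma image_in_family: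
  assumes "norm P = 2" "norm Q = 2" "norm R = 2" "P \<bullet> Q = -2" "Q \<bullet> R = -2" "R \<bullet> P = -2"
  shows "(f P, f Q, f R) \<in> poncelet_family E C r"
proof -
  have "P + Q + R = 0" by (rule sum_eq_0_of_equilateral) fact+
  then have "\<not> collinear {P, Q, R}" using not_collinear_equilateral assms by blast
  moreover from this have "P \<noteq> Q" "Q \<noteq> R" "R \<noteq> P" by (auto simp: insert_commute)
  ultimately show ?thesis
    using assms not_collinear_image[of P Q R] w_pos f_double sideline_tangent_iff
    by (simp add: poncelet_family_def)
qed

text \<open>Vertices that are not collinear are distinct, so the tangency of each side fixes the inner
  product of the preimages of its ends.\<close>

lemma family_is_image:
  assumes "(A, B, D) \<in> poncelet_family E C r"
  obtains P Q R where "A = f P" "B = f Q" "D = f R" "norm P = 2" "norm Q = 2" "norm R = 2"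
    "P \<bullet> Q = -2" "Q \<bullet> R = -2" "R \<bullet> P = -2"
proof -
  have "A \<in> E" "B \<in> E" "D \<in> E" and nc: "\<not> collinear {A, B, D}"
    and t: "sideline_tangent B D C r" "sideline_tangent D A C r" "sideline_tangent A B C r"
    using assms by (auto simp: poncelet_family_def)
  then have n: "norm (g A) = 2" "norm (g B) = 2" "norm (g D) = 2"
    and e: "f (g A) = A" "f (g B) = B" "f (g D) = D" using g_E fg by auto
  have "A \<noteq> B" "B \<noteq> D" "D \<noteq> A" using nc by (auto simp: insert_commute)
  then have "g A \<noteq> g B" "g B \<noteq> g D" "g D \<noteq> g A" using e by metis+
  then have "g A \<bullet> g B = -2" "g B \<bullet> g D = -2" "g D \<bullet> g A = -2"
    using t n e sideline_tangent_iff by metis+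
  then show thesis using that[of "g A" "g B" "g D"] n e by simp
qed

lemma caustic: "poncelet_triangle_caustic E C r"
  unfolding poncelet_triangle_caustic_def
proof (intro conjI ballI r)
  fix A assume "A \<in> E"
  then have A: "norm (g A) = 2" "f (g A) = A" using g_E fg by auto
  obtain Q R where "norm Q = 2" "norm R = 2" "g A \<bullet> Q = -2" "Q \<bullet> R = -2" "R \<bullet> g A = -2"
    using equilateral_exists A(1) by blast
  then show "\<exists>B D. (A, B, D) \<in> poncelet_family E C r"
    using image_in_family[of "g A" Q R] A by metis
qed

lemma incircle:
  assumes "(A, B, D) \<in> poncelet_family E C r"
  shows "is_incircle A B D C r"
proof -
  obtain P Q R where PQR: "A = f P" "B = f Q" "D = f R" "norm P = 2" "norm Q = 2" "norm R = 2"
    "P \<bullet> Q = -2" "Q \<bullet> R = -2" "R \<bullet> P = -2"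
    using family_is_image[OF assms] .
  have "sphere C r \<subseteq> convex hull {A, B, D}"
  proof
    fix y assume y: "y \<in> sphere C r"
    then have "g y \<in> sphere 0 1" using g_sphere by simp
    then have "g y \<in> convex hull {P, Q, R}"
      using equilateral_contains_incircle[of P Q R] PQR by blast
    then have "f (g y) \<in> convex hull (f ` {P, Q, R})"
      by (rule fractional_affine_convex_hull[OF f, rotated]) (use w_pos PQR in auto)
    then show "y \<in> convex hull {A, B, D}" using fg g_sphere y PQR by simp
  qed
  then show ?thesis using assms r by (simp add: is_incircle_def poncelet_family_def)
qed

text \<open>The cevians of an equilateral triangle pass through its centre, so their images pass through
  \<open>f 0\<close>. A second common point of two cevians would make these lines coincide, and then the centre
  would be collinear with two vertices of the equilateral triangle.\<close>

lemma gergonne: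
  assumes "(A, B, D) \<in> poncelet_family E C r"
  shows "is_gergonne_point A B D (f 0)"
proof -
  obtain P Q R where PQR: "A = f P" "B = f Q" "D = f R" "norm P = 2" "norm Q = 2" "norm R = 2"
    "P \<bullet> Q = -2" "Q \<bullet> R = -2" "R \<bullet> P = -2"
    using family_is_image[OF assms] .
  have sum: "P + Q + R = 0" by (rule sum_eq_0_of_equilateral) fact+
  let ?m = "\<lambda>V. f (- (1/2) *\<^sub>R V)"
  have touch: "line_touches_circle_at B D C r (?m P)" "line_touches_circle_at D A C r (?m Q)"
    "line_touches_circle_at A B C r (?m R)"
    using touches_at[of Q R P] touches_at[of R P Q] touches_at[of P Q R] PQR sum
    by (simp_all add: add_ac)
  have cevian: "f 0 \<in> affine hull {f V, ?m V}" if "norm V = 2" for V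
  proof -
    have "(0::real \<times> real) = (1/3) *\<^sub>R V + (2/3) *\<^sub>R (- (1/2) *\<^sub>R V)" by simp
    then have "0 \<in> affine hull {V, - (1/2) *\<^sub>R V}"
      unfolding affine_hull_2 mem_Collect_eq by (intro exI[of _ "1/3"] exI[of _ "2/3"]) simp
    then show ?thesis by (rule fractional_affine_line[OF f, rotated 3]) (use that w_pos in auto)
  qed
  \<comment> \<open>The common point \<open>Z\<close> need not lie in the half plane \<open>v > 0\<close>, so it cannot be pulled back;
      only vertices and \<open>f 0\<close> are.\<close>
  have "Z = f 0" if Z: "Z \<in> affine hull {A, ?m P}" "Z \<in> affine hull {B, ?m Q}" for Z
  proof (rule ccontr)
    assume "Z \<noteq> f 0"
    have "collinear {f V, Z, f 0}" if "norm V = 2" "Z \<in> affine hull {f V, ?m V}" for V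
    proof -
      have "{f V, Z, f 0} \<subseteq> affine hull {f V, ?m V}"
        using that cevian by (auto intro: hull_inc)
      then show ?thesis by (meson collinear_2 collinear_affine_hull_collinear collinear_subset)
    qed
    then have "collinear {f P, Z, f 0}" "collinear {f Q, Z, f 0}" using Z PQR by auto
    then have "collinear {f P, f 0, f Q}"
      using collinear_3_trans[of "f P" "f 0" Z "f Q"] \<open>Z \<noteq> f 0\<close> by (simp add: insert_commute)
    then show False
      using not_collinear_image[of 0 P Q] not_collinear_0_of_equilateral[of P Q] w_pos PQR
      by (simp add: insert_commute)
  qed
  then have "affine hull {A, ?m P} \<inter> affine hull {B, ?m Q} \<inter> affine hull {D, ?m R} = {f 0}"
    using cevian PQR by blast
  then show ?thesis
    unfolding is_gergonne_point_def using incircle[OF assms] touch by blast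
qed

end

section \<open>Translations of the Klein disk\<close>

text \<open>The hyperbolic translation of the unit disk, in the Klein model, that takes the centre to
  \<open>(s, 0)\<close>.\<close>

definition disk_shift :: "real \<Rightarrow> real \<times> real \<Rightarrow> real \<times> real" where
  "disk_shift s = (\<lambda>(x, y). ((x + s) / (1 + s * x), sqrt (1 - s\<^sup>2) * y / (1 + s * x)))"

lemma disk_shift_inverse:
  assumes "\<bar>s\<bar> < 1" "1 + s * fst z > 0"
  shows "1 - s * fst (disk_shift s z) > 0" "disk_shift (- s) (disk_shift s z) = z"
proof -
  obtain x y where z: "z = (x, y)" by (cases z)
  have s: "1 - s\<^sup>2 > 0" using assms(1) by (simp add: abs_square_less_1)
  have d: "1 + s * x > 0" using assms(2) z by simp
  have e: "1 - s * ((x + s) / (1 + s * x)) = (1 - s\<^sup>2) / (1 + s * x)"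
    using d by (simp add: field_simps power2_eq_square)
  show "1 - s * fst (disk_shift s z) > 0"
    using e s d by (simp add: z disk_shift_def)
  have "((x + s) / (1 + s * x) - s) = (1 - s\<^sup>2) * x / (1 + s * x)"
    using d by (simp add: field_simps power2_eq_square)
  then show "disk_shift (- s) (disk_shift s z) = z"
    using e s d by (simp add: z disk_shift_def mult.assoc[symmetric])
qed

lemma norm_pair_eq_iff:
  fixes x y n :: real
  assumes "n \<ge> 0"
  shows "norm (x, y) = n \<longleftrightarrow> x\<^sup>2 + y\<^sup>2 = n\<^sup>2"
  using assms by (auto simp: norm_Pair real_sqrt_unique)

lemma norm_disk_shift:
  assumes "\<bar>s\<bar> < 1" "norm z = 1"
  shows "norm (disk_shift s z) = 1"
proof -
  obtain x y where z: "z = (x, y)" by (cases z)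
  have "1 - s\<^sup>2 > 0" using assms(1) by (simp add: abs_square_less_1)
  have xy: "x\<^sup>2 + y\<^sup>2 = 1" using assms(2) norm_pair_eq_iff[of 1 x y] z by simp
  have "\<bar>x\<bar> \<le> 1" using norm_fst_le[of x y] assms(2) z by simp
  then have "\<bar>s * x\<bar> < 1" using assms(1) by (simp add: abs_mult) (smt (verit) mult_left_le abs_ge_zero)
  then have d: "1 + s * x \<noteq> 0" by auto
  have "(x + s)\<^sup>2 + (1 - s\<^sup>2) * y\<^sup>2 = (1 + s * x)\<^sup>2" using xy by algebra
  then have "((x + s) / (1 + s * x))\<^sup>2 + (sqrt (1 - s\<^sup>2) * y / (1 + s * x))\<^sup>2 = 1"
    using d \<open>1 - s\<^sup>2 > 0\<close>
    by (simp add: power_divide power_mult_distrib add_divide_distrib[symmetric])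
  then show ?thesis by (simp add: z disk_shift_def norm_pair_eq_iff)
qed

lemma fractional_affine_disk_shift: "fractional_affine (\<lambda>z. 1 + s * fst z) (disk_shift s)"
proof -
  have wf: "(1 + s * fst z) *\<^sub>R disk_shift s z = (fst z + s, sqrt (1 - s\<^sup>2) * snd z)"
    if "1 + s * fst z > 0" for z
    using that by (cases z) (simp add: disk_shift_def)
  show ?thesis
    unfolding fractional_affine_def
  proof (intro allI impI conjI)
    fix x y :: "real \<times> real" and p q :: real
    assume pq: "p + q = 1"
    let ?z = "p *\<^sub>R x + q *\<^sub>R y"
    have q: "q = 1 - p" using pq by simp
    show "1 + s * fst ?z = p * (1 + s * fst x) + q * (1 + s * fst y)"
      by (simp add: q algebra_simps)
    assume "1 + s * fst x > 0" "1 + s * fst y > 0" "1 + s * fst ?z > 0"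
    then show "(1 + s * fst ?z) *\<^sub>R disk_shift s ?z =
        (p * (1 + s * fst x)) *\<^sub>R disk_shift s x + (q * (1 + s * fst y)) *\<^sub>R disk_shift s y"
      unfolding scaleR_scaleR[symmetric] by (simp only: wf) (simp add: q algebra_simps)
  qed
qed

lemma fractional_affine_post:
  fixes f :: "'a::real_vector \<Rightarrow> 'b::real_vector"
  assumes "fractional_affine w f"
  shows "fractional_affine w (\<lambda>x. c + k *\<^sub>R f x)"
  unfolding fractional_affine_def
proof (intro allI impI conjI)
  fix x y :: 'a and s t :: real
  assume st: "s + t = 1"
  let ?z = "s *\<^sub>R x + t *\<^sub>R y"
  show w: "w ?z = s * w x + t * w y"
    using assms st unfolding fractional_affine_def by blast
  assume "w x > 0" "w y > 0" "w ?z > 0"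
  then have wf: "w ?z *\<^sub>R f ?z = (s * w x) *\<^sub>R f x + (t * w y) *\<^sub>R f y"
    using assms st unfolding fractional_affine_def by blast
  have "w ?z *\<^sub>R (c + k *\<^sub>R f ?z) = w ?z *\<^sub>R c + k *\<^sub>R (w ?z *\<^sub>R f ?z)"
    by (simp add: scaleR_add_right)
  then show "w ?z *\<^sub>R (c + k *\<^sub>R f ?z) = (s * w x) *\<^sub>R (c + k *\<^sub>R f x) + (t * w y) *\<^sub>R (c + k *\<^sub>R f y)"
    unfolding wf unfolding w by (simp add: algebra_simps)
qed

lemma fractional_affine_pre:
  assumes "fractional_affine w f"
  shows "fractional_affine (\<lambda>x. w (k *\<^sub>R (x - c))) (\<lambda>x. f (k *\<^sub>R (x - c)))"
proof -
  have *: "k *\<^sub>R (s *\<^sub>R x + t *\<^sub>R y - c) = s *\<^sub>R (k *\<^sub>R (x - c)) + t *\<^sub>R (k *\<^sub>R (y - c))"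
    if "s + t = 1" for s t x y
  proof -
    have t: "t = 1 - s" using that by simp
    show ?thesis unfolding t by (simp add: algebra_simps)
  qed
  show ?thesis
    unfolding fractional_affine_def
  proof (intro allI impI)
    fix x y and s t :: real
    assume st: "s + t = 1"
    show "w (k *\<^sub>R (s *\<^sub>R x + t *\<^sub>R y - c)) = s * w (k *\<^sub>R (x - c)) + t * w (k *\<^sub>R (y - c)) \<and>
      (w (k *\<^sub>R (x - c)) > 0 \<longrightarrow> w (k *\<^sub>R (y - c)) > 0 \<longrightarrow> w (k *\<^sub>R (s *\<^sub>R x + t *\<^sub>R y - c)) > 0 \<longrightarrow>
        w (k *\<^sub>R (s *\<^sub>R x + t *\<^sub>R y - c)) *\<^sub>R f (k *\<^sub>R (s *\<^sub>R x + t *\<^sub>R y - c)) =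
        (s * w (k *\<^sub>R (x - c))) *\<^sub>R f (k *\<^sub>R (x - c)) + (t * w (k *\<^sub>R (y - c))) *\<^sub>R f (k *\<^sub>R (y - c)))"
      unfolding *[OF st] using assms st unfolding fractional_affine_def by blast
  qed
qed

text \<open>Under the assumptions the map is \<open>(x, y) \<mapsto> (a * (2 * s + x / 2), b * q * y / 2) / (1 + s * x)\<close>
  with \<open>q\<^sup>2 = 1 - 4 * s\<^sup>2\<close>. This is the translation by \<open>2 * s\<close> of the disk of radius 2 scaled to the
  unit disk, followed by the stretching of the unit circle to the ellipse. The two equations \<open>c\<close>
  and \<open>r\<close> match the first coordinates and \<open>rb\<close> the second ones.\<close>

lemma shifted_circle_in_ellipse_iff:
  fixes a b c r s :: real
  assumes pos: "a > 0" "b > 0" "s\<^sup>2 < 1 / 4"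
    and c: "c + r * s = 2 * a * s" and r: "c * s + r = a / 2"
    and rb: "r\<^sup>2 * (1 - s\<^sup>2) = b\<^sup>2 * (1 - 4 * s\<^sup>2) / 4"
    and w: "1 + s * fst z \<noteq> 0"
  shows "(c, 0) + r *\<^sub>R disk_shift s z \<in> ellipse a b \<longleftrightarrow> norm z = 2"
proof -
  obtain x y where z: "z = (x, y)" by (cases z)
  let ?w = "1 + s * x"
  have w: "?w \<noteq> 0" using assms(7) z by simp
  have "(c, 0) + r *\<^sub>R disk_shift s z = (c + r * ((x + s) / ?w), r * (sqrt (1 - s\<^sup>2) * y / ?w))"
    by (simp add: z disk_shift_def)
  moreover have "c + r * ((x + s) / ?w) = a * ((2 * s + x / 2) / ?w)"
  proof -
    have "c + r * ((x + s) / ?w) = (c * ?w + r * (x + s)) / ?w"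
      unfolding add_divide_distrib[of "c * ?w"] using w by simp
    also have "c * ?w + r * (x + s) = a * (2 * s + x / 2)" using c r by algebra
    finally show ?thesis by simp
  qed
  moreover have "(r * (sqrt (1 - s\<^sup>2) * y / ?w) / b)\<^sup>2 = (1 - 4 * s\<^sup>2) * y\<^sup>2 / 4 / ?w\<^sup>2"
  proof -
    have "(r * (sqrt (1 - s\<^sup>2) * y / ?w) / b)\<^sup>2 = r\<^sup>2 * (1 - s\<^sup>2) * y\<^sup>2 / ?w\<^sup>2 / b\<^sup>2"
      using pos by (simp add: power_mult_distrib power_divide)
    then show ?thesis unfolding rb using pos by simp
  qed
  ultimately have "(c, 0) + r *\<^sub>R disk_shift s z \<in> ellipse a b \<longleftrightarrow>
      ((2 * s + x / 2) / ?w)\<^sup>2 + (1 - 4 * s\<^sup>2) * y\<^sup>2 / 4 / ?w\<^sup>2 = 1"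
    using pos by (simp add: ellipse_def)
  also have "\<dots> \<longleftrightarrow> (2 * s + x / 2)\<^sup>2 + (1 - 4 * s\<^sup>2) * y\<^sup>2 / 4 = ?w\<^sup>2"
    unfolding power_divide add_divide_distrib[symmetric] using w by auto
  also have "\<dots> \<longleftrightarrow> (1 - 4 * s\<^sup>2) * (x\<^sup>2 + y\<^sup>2 - 4) = 0"
  proof -
    have key: "(2 * s + x / 2)\<^sup>2 + (1 - 4 * s\<^sup>2) * y\<^sup>2 / 4 - ?w\<^sup>2 = (1 - 4 * s\<^sup>2) * (x\<^sup>2 + y\<^sup>2 - 4) / 4"
      by (simp add: power2_eq_square field_simps)
    show ?thesis unfolding eq_iff_diff_eq_0[of _ "?w\<^sup>2"] key by simp
  qed
  also have "\<dots> \<longleftrightarrow> norm z = 2"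
    using pos by (simp add: z norm_pair_eq_iff)
  finally show ?thesis .
qed

section \<open>The ellipse and its incircle\<close>

theorem proposition8:
  fixes a b k7 r7 :: real and C7 X7 :: "real \<times> real"
  assumes "a > b" and "b > 0"
    and "k7 = sqrt (4 * a ^ 4 - 5 * a\<^sup>2 * b\<^sup>2 + b ^ 4)"
    and "C7 = (k7 / (2 * a), 0)"
    and "r7 = b\<^sup>2 / (2 * a)"
    and "X7 = (2 * a * k7 / (4 * a\<^sup>2 - b\<^sup>2), 0)"
  shows "poncelet_triangle_caustic (ellipse a b) C7 r7 \<and>
    (\<forall>(A, B, C) \<in> poncelet_family (ellipse a b) C7 r7.
       is_incircle A B C C7 r7 \<and> is_gergonne_point A B C X7)"
proof -
  define d where "d = 4 * a\<^sup>2 - b\<^sup>2"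
  \<comment> \<open>The shift that takes the centre to \<open>(X7 - C7) / r7\<close>.\<close>
  define s where "s = k7 / d"
  let ?c = "k7 / (2 * a)"
  have a: "a > 0" using assms by simp
  have ab: "b\<^sup>2 < a\<^sup>2" using assms(1,2) by (simp add: power_strict_mono)
  have d: "d > 0" using ab assms(2) unfolding d_def by (smt (verit) zero_le_power2)
  have b2: "b\<^sup>2 = 4 * a\<^sup>2 - d" by (simp add: d_def)
  have k2: "k7\<^sup>2 = d * (a\<^sup>2 - b\<^sup>2)" and k0: "k7 \<ge> 0"
  proof -
    have "4 * a ^ 4 - 5 * a\<^sup>2 * b\<^sup>2 + b ^ 4 = d * (a\<^sup>2 - b\<^sup>2)"
      unfolding d_def by algebra
    moreover have "\<dots> \<ge> 0" using d ab by simp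
    ultimately show "k7\<^sup>2 = d * (a\<^sup>2 - b\<^sup>2)" "k7 \<ge> 0" using assms(3) by simp_all
  qed
  have s0: "s \<ge> 0" using k0 d by (simp add: s_def)
  have k: "k7 = s * d" using d by (simp add: s_def)
  have s2: "s\<^sup>2 * d = a\<^sup>2 - b\<^sup>2"
    using k2 d unfolding k by (simp add: power2_eq_square)
  then have "4 * (s\<^sup>2 * d) < 1 * d" using assms(2) unfolding d_def by simp
  then have "(4 * s\<^sup>2) * d < 1 * d" by (simp only: mult.assoc)
  then have s4: "s\<^sup>2 < 1 / 4" using d mult_less_cancel_right_pos[OF d] by auto
  then have s_half: "s < 1 / 2" using power2_less_imp_less[of s "1/2"] by (simp add: power_divide)
  have r0: "r7 > 0" using assms(2,5) a by simp
  have c1: "?c + r7 * s = 2 * a * s"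
  proof -
    have "?c + r7 * s = (d + b\<^sup>2) * s / (2 * a)"
      by (simp add: k assms(5) add_divide_distrib[symmetric] algebra_simps)
    also have "\<dots> = 2 * a * s" unfolding b2 using a by (simp add: power2_eq_square)
    finally show ?thesis .
  qed
  have c2: "?c * s + r7 = a / 2"
  proof -
    have "?c * s + r7 = (s\<^sup>2 * d + b\<^sup>2) / (2 * a)"
      by (simp add: k assms(5) power2_eq_square add_divide_distrib mult_ac)
    also have "\<dots> = a / 2" unfolding s2 using a by (simp add: power2_eq_square)
    finally show ?thesis .
  qed
  have c3: "r7\<^sup>2 * (1 - s\<^sup>2) = b\<^sup>2 * (1 - 4 * s\<^sup>2) / 4"
  proof -
    have "d * (1 - s\<^sup>2) = 3 * a\<^sup>2" "d * (1 - 4 * s\<^sup>2) = 3 * b\<^sup>2"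
      using s2 unfolding d_def by algebra+
    then have e: "1 - s\<^sup>2 = 3 * a\<^sup>2 / d" "1 - 4 * s\<^sup>2 = 3 * b\<^sup>2 / d"
      using d by (simp_all add: field_simps)
    show ?thesis unfolding e assms(5) using a by (simp add: power_divide power2_eq_square)
  qed
  define w where "w = (\<lambda>z::real \<times> real. 1 + s * fst z)"
  define f where "f = (\<lambda>z. C7 + r7 *\<^sub>R disk_shift s z)"
  define v where "v = (\<lambda>y::real \<times> real. 1 + (- s) * fst ((1 / r7) *\<^sub>R (y - C7)))"
  define g where "g = (\<lambda>y. disk_shift (- s) ((1 / r7) *\<^sub>R (y - C7)))"
  have wv: "v (f z) > 0" "g (f z) = z" if "w z > 0" for z
    using disk_shift_inverse[of s z] that s0 s_half r0 by (simp_all add: w_def v_def f_def g_def)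
  have vw: "w (g y) > 0" "f (g y) = y" if "v y > 0" for y
    using disk_shift_inverse[of "- s" "(1 / r7) *\<^sub>R (y - C7)"] that s0 s_half r0
    by (simp_all add: w_def v_def f_def g_def)
  have ell: "f z \<in> ellipse a b \<longleftrightarrow> norm z = 2" if "w z > 0" for z
    using shifted_circle_in_ellipse_iff[OF a assms(2) s4 c1 c2 c3, of z] that
    by (simp add: f_def w_def assms(4))
  interpret projective_picture f g w v "ellipse a b" C7 r7
  proof
    show "fractional_affine w f"
      unfolding w_def f_def by (intro fractional_affine_post fractional_affine_disk_shift)
    show "fractional_affine v g"
      unfolding v_def g_def by (intro fractional_affine_pre[OF fractional_affine_disk_shift])
    show "w x > 0" if "norm x \<le> 2" for x
    proof -
      have "\<bar>fst x\<bar> \<le> 2" using that norm_fst_le[of "fst x" "snd x"] by simp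
      then have "\<bar>s * fst x\<bar> \<le> s * 2" using s0 by (simp add: abs_mult mult_left_mono)
      then show ?thesis using s_half by (simp add: w_def)
    qed
    then show "f x \<in> ellipse a b" if "norm x = 2" for x using ell that by simp
    show "f x \<in> sphere C7 r7" if "norm x = 1" for x
      using norm_disk_shift[of s x] that s0 s_half r0 by (simp add: f_def dist_norm)
    show "v y > 0 \<and> norm (g y) = 1" if "y \<in> sphere C7 r7" for y
    proof -
      define u where "u = (1 / r7) *\<^sub>R (y - C7)"
      have u: "norm u = 1" using that r0 by (simp add: u_def dist_norm norm_minus_commute)
      then have "norm (g y) = 1"
        unfolding g_def u_def[symmetric] using norm_disk_shift[OF _ u, of "- s"] s0 s_half by simp
      moreover have "fst u \<le> 1" using u norm_fst_le[of "fst u" "snd u"] by simp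
      then have "s * fst u \<le> s * 1" using s0 by (intro mult_left_mono)
      then have "v y > 0" unfolding v_def u_def[symmetric] using s_half by simp
      ultimately show ?thesis by simp
    qed
    show "v y > 0 \<and> norm (g y) = 2" if y: "y \<in> ellipse a b" for y
    proof -
      \<comment> \<open>The line sent to infinity lies to the right of the vertex \<open>(a, 0)\<close>, because \<open>s < 1 / 2\<close>.\<close>
      have "(fst y / a)\<^sup>2 \<le> 1"
        using y unfolding ellipse_def by (auto simp: case_prod_unfold) (smt (verit) zero_le_power2)
      then have "fst y \<le> a" using a by (simp add: abs_square_le_1)
      then have "s * (fst y - ?c) \<le> s * (a - ?c)" using s0 by (intro mult_left_mono) auto
      also have "\<dots> = a * s - a / 2 + r7" using c2 by (simp add: algebra_simps)
      also have "\<dots> < r7" using a s_half by simp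
      finally have "v y > 0" using r0 by (simp add: v_def assms(4) field_simps)
      then show ?thesis using ell[of "g y"] vw y by simp
    qed
  qed (use wv vw r0 in auto)
  have "f 0 = (?c + r7 * s, 0)" by (simp add: f_def disk_shift_def zero_prod_def assms(4))
  also have "\<dots> = X7" unfolding c1 by (simp add: assms(6) s_def d_def)
  finally show ?thesis using caustic incircle gergonne by auto
qed

end
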